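(* Let $w\in\mathbb R^n_{++}$, $b\in\mathbb R^n$ and $c\in\mathbb R$ satisfy $c<\sum_{i=1}^n w_i b_i$. Then the algorithm DTA described in the context, run on input $(w,b,c)$, terminates after finitely many steps and returns an optimal solution of the problem $$\text{(P)}\quad \min_{x\in\mathbb R^n}\ \sum_{i=1}^n w_i x_i^2\quad\text{s.t.}\quad \sum_{i=1}^n w_i x_i=c,\quad x\le b.$$
   Context: $\mathbb R^n_{++}$ denotes the set of vectors with strictly positive entries. **Dynamic-Threshold Algorithm (DTA).** Input: $w\in\mathbb R^n_{++}$, $b\in\mathbb R^n$, $c\in\mathbb R$ with $c<\sum_{i=1}^n w_i b_i$. The variables are index sets $\mathcal S,\mathcal J\subseteq\{1,\dots,n\}$ and reals $W,\tau$; assignments are executed sequentially. Step 1. Set $\mathcal J=\emptyset$, $\mathcal S=\{1\}$, $D=\sum_{i=1}^n w_i b_i-c$, $W=w_1$, $\tau=(w_1b_1-D)/W$. Step 2. For $i=2,\ldots,n$: if $b_i>\tau$, set $W\leftarrow W+w_i$ and then $\tau\leftarrow\tau+w_i(b_i-\tau)/W$. Then, with $\rho_i=b_i-D/w_i$: if $\tau>\rho_i$, set $\mathcal S\leftarrow\mathcal S\cup\{i\}$; otherwise (reset) set $\mathcal J\leftarrow\mathcal J\cup\mathcal S$, $\mathcal S\leftarrow\{i\}$, $W\leftarrow w_i$, $\tau\leftarrow\rho_i$. (If $b_i\le\tau$, index $i$ is skipped.) Step 3. If $\mathcal J\ne\emptyset$, for every $j\in\mathcal J$: if $b_j>\tau$,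 set $\mathcal S\leftarrow\mathcal S\cup\{j\}$, $W\leftarrow W+w_j$, and then $\tau\leftarrow\tau+w_j(b_j-\tau)/W$. Step 4 (removal). Repeat the following pass until a pass leaves $|\mathcal S|$ unchanged: visit every element $i\in\mathcal S$ once; whenever the visited $i$ satisfies $b_i\le\tau$ (with the current $\tau$), set $\mathcal S\leftarrow\mathcal S\setminus\{i\}$, $W\leftarrow W-w_i$, and then $\tau\leftarrow\tau+w_i(\tau-b_i)/W$. Step 5. Return $x^*$ with $x_i^*=\tau$ for $i\in\mathcal S$ and $x_i^*=b_i$ for $i\notin\mathcal S$. *)

theory Defs
  imports Complex_Main
begin

text \<open>Vectors in real \<open>n\<close>-space are functions \<open>nat \<Rightarrow> real\<close> of which only the values on
  \<open>{1..n}\<close> matter. Problem (P) is to minimise \<open>objective\<close> over the \<open>feasible\<close> points.\<close>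

definition objective :: "nat \<Rightarrow> (nat \<Rightarrow> real) \<Rightarrow> (nat \<Rightarrow> real) \<Rightarrow> real" where
  "objective n w x = (\<Sum>i=1..n. w i * (x i)\<^sup>2)"

definition feasible ::
  "nat \<Rightarrow> (nat \<Rightarrow> real) \<Rightarrow> (nat \<Rightarrow> real) \<Rightarrow> real \<Rightarrow> (nat \<Rightarrow> real) \<Rightarrow> bool" where
  "feasible n w b c x \<longleftrightarrow> (\<Sum>i=1..n. w i * x i) = c \<and> (\<forall>i\<in>{1..n}. x i \<le> b i)"

definition optimal_solution ::
  "nat \<Rightarrow> (nat \<Rightarrow> real) \<Rightarrow> (nat \<Rightarrow> real) \<Rightarrow> real \<Rightarrow> (nat \<Rightarrow> real) \<Rightarrow> bool" where
  "optimal_solution n w b c x \<longleftrightarrow> is_arg_min (objective n w) (feasible n w b c) x"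

text \<open>The algorithm is a small-step transition system, nondeterministic because the order in
  which the elements of the index sets are visited is left open. A configuration consists of a
  program point with the current values of the live variables:
  \<^item> \<open>Scan i J S W \<tau>\<close>: Step 2 is about to process index \<open>i\<close>.
  \<^item> \<open>Reinsert P S W \<tau>\<close>: Step 3, with \<open>P\<close> the elements of \<open>J\<close> still to be visited.
  \<^item> \<open>Remove P m S W \<tau>\<close>: a pass of Step 4, with \<open>P\<close> the elements still to be visited in
    this pass and \<open>m\<close> the cardinality of \<open>S\<close> when the pass began.
  \<^item> \<open>Returned x\<close>: the algorithm has halted with output \<open>x\<close>.\<close>

datatype dta_config =
    Scan nat "nat set" "nat set" real real
  | Reinsert "nat set" "nat set" real real
  | Remove "nat set" nat "nat set" real real
  | Returned "nat \<Rightarrow> real"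

definition deficit :: "nat \<Rightarrow> (nat \<Rightarrow> real) \<Rightarrow> (nat \<Rightarrow> real) \<Rightarrow> real \<Rightarrow> real" where
  "deficit n w b c = (\<Sum>i=1..n. w i * b i) - c"

definition dta_rho :: "nat \<Rightarrow> (nat \<Rightarrow> real) \<Rightarrow> (nat \<Rightarrow> real) \<Rightarrow> real \<Rightarrow> nat \<Rightarrow> real" where
  "dta_rho n w b c i = b i - deficit n w b c / w i"

definition dta_init :: "nat \<Rightarrow> (nat \<Rightarrow> real) \<Rightarrow> (nat \<Rightarrow> real) \<Rightarrow> real \<Rightarrow> dta_config" where
  "dta_init n w b c = Scan 2 {} {1} (w 1) ((w 1 * b 1 - deficit n w b c) / w 1)"

text \<open>The only division whose divisor is not evidently nonzero is that in \<open>remove_drop\<close>. Since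
  \<open>x / 0 = 0\<close> in HOL, the rule explicitly demands a nonzero divisor: a run that would divide
  by zero gets stuck in a configuration other than \<open>Returned x\<close>.\<close>

inductive dta_step ::
  "nat \<Rightarrow> (nat \<Rightarrow> real) \<Rightarrow> (nat \<Rightarrow> real) \<Rightarrow> real \<Rightarrow> dta_config \<Rightarrow> dta_config \<Rightarrow> bool"
  for n :: nat and w b :: "nat \<Rightarrow> real" and c :: real where
  scan_skip:
    "\<lbrakk>i \<le> n; b i \<le> \<tau>\<rbrakk>
     \<Longrightarrow> dta_step n w b c (Scan i J S W \<tau>) (Scan (Suc i) J S W \<tau>)"
| scan_add:
    "\<lbrakk>i \<le> n; b i > \<tau>; W' = W + w i; \<tau>' = \<tau> + w i * (b i - \<tau>) / W';
      \<tau>' > dta_rho n w b c i\<rbrakk>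
     \<Longrightarrow> dta_step n w b c (Scan i J S W \<tau>) (Scan (Suc i) J (S \<union> {i}) W' \<tau>')"
| scan_reset:
    "\<lbrakk>i \<le> n; b i > \<tau>; W' = W + w i; \<tau>' = \<tau> + w i * (b i - \<tau>) / W';
      \<not> \<tau>' > dta_rho n w b c i\<rbrakk>
     \<Longrightarrow> dta_step n w b c (Scan i J S W \<tau>)
           (Scan (Suc i) (J \<union> S) {i} (w i) (dta_rho n w b c i))"
| scan_done:
    "i > n \<Longrightarrow> dta_step n w b c (Scan i J S W \<tau>) (Reinsert J S W \<tau>)"
| reinsert_skip:
    "\<lbrakk>j \<in> P; b j \<le> \<tau>\<rbrakk>
     \<Longrightarrow> dta_step n w b c (Reinsert P S W \<tau>) (Reinsert (P - {j}) S W \<tau>)"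
| reinsert_add:
    "\<lbrakk>j \<in> P; b j > \<tau>; W' = W + w j; \<tau>' = \<tau> + w j * (b j - \<tau>) / W'\<rbrakk>
     \<Longrightarrow> dta_step n w b c (Reinsert P S W \<tau>) (Reinsert (P - {j}) (S \<union> {j}) W' \<tau>')"
| reinsert_done:
    "dta_step n w b c (Reinsert {} S W \<tau>) (Remove S (card S) S W \<tau>)"
| remove_keep:
    "\<lbrakk>i \<in> P; b i > \<tau>\<rbrakk>
     \<Longrightarrow> dta_step n w b c (Remove P m S W \<tau>) (Remove (P - {i}) m S W \<tau>)"
| remove_drop:
    "\<lbrakk>i \<in> P; b i \<le> \<tau>; W' = W - w i; W' \<noteq> 0; \<tau>' = \<tau> + w i * (\<tau> - b i) / W'\<rbrakk>
     \<Longrightarrow> dta_step n w b c (Remove P m S W \<tau>) (Remove (P - {i}) m (S - {i}) W' \<tau>')"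
| remove_again:
    "card S \<noteq> m
     \<Longrightarrow> dta_step n w b c (Remove {} m S W \<tau>) (Remove S (card S) S W \<tau>)"
| remove_done:
    "card S = m
     \<Longrightarrow> dta_step n w b c (Remove {} m S W \<tau>) (Returned (\<lambda>i. if i \<in> S then \<tau> else b i))"

end

theory Submission imports Defs
begin

text \<open>Throughout a run, \<open>W\<close> is the total weight of \<open>S\<close> and \<open>\<tau>\<close> is the root of
  \<open>(\<Sum>i\<in>S. w i * (b i - \<tau>)) = D\<close>. Every update of \<open>\<tau>\<close> increases it, so an index once skipped or
  removed because of \<open>b i \<le> \<tau>\<close> satisfies this inequality for ever after. Since \<open>D > 0\<close>, some
  element of \<open>S\<close> lies strictly above \<open>\<tau>\<close>, so a removal never empties \<open>S\<close>. When a removal pass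
  changes nothing, \<open>S\<close> consists exactly of the indices with \<open>b i > \<tau>\<close>, which makes the output
  \<open>min (b i) \<tau>\<close>, the solution of the KKT conditions.\<close>

locale dta_input =
  fixes n :: nat and w b :: "nat \<Rightarrow> real" and c :: real
  assumes n_pos: "n \<ge> 1"
    and w_pos: "i \<in> {1..n} \<Longrightarrow> w i > 0"
    and infeasible_bound: "c < (\<Sum>i=1..n. w i * b i)"
begin

abbreviation "D \<equiv> deficit n w b c"

lemma D_pos: "D > 0"
  using infeasible_bound by (simp add: deficit_def)

text \<open>The equation is kept multiplied out rather than solved for \<open>\<tau>\<close>, so it
  involves no division. For empty \<open>S\<close> it would read \<open>0 = D\<close>, which
  \<open>D_pos\<close> excludes.\<close>

definition threshold :: "nat set \<Rightarrow> real \<Rightarrow> real \<Rightarrow> bool" where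
  "threshold S W \<tau> \<longleftrightarrow>
     S \<subseteq> {1..n} \<and> W = sum w S \<and> (\<Sum>i\<in>S. w i * b i) - W * \<tau> = D"

lemma threshold_finite: "threshold S W \<tau> \<Longrightarrow> finite S"
  unfolding threshold_def using finite_subset by blast

lemma sum_w_nonneg: "S \<subseteq> {1..n} \<Longrightarrow> sum w S \<ge> 0"
  by (meson less_eq_real_def subsetD sum_nonneg w_pos)

text \<open>This justifies the value assigned on a reset, and also the start, because the initial
  \<open>\<tau>\<close> equals \<open>dta_rho n w b c 1\<close>.\<close>

lemma threshold_singleton:
  assumes "i \<in> {1..n}"
  shows "threshold {i} (w i) (dta_rho n w b c i)"
  using assms w_pos[OF assms] by (simp add: threshold_def dta_rho_def field_simps)

text \<open>The new threshold is the weighted mean of \<open>\<tau>\<close> and \<open>b j\<close>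
  with weights \<open>W\<close> and \<open>w j\<close>; as \<open>b j > \<tau>\<close>, it moves
  upwards.\<close>

lemma threshold_insert:
  assumes thr: "threshold S W \<tau>" and j: "j \<in> {1..n}" "j \<notin> S" "b j > \<tau>"
  defines "\<tau>' \<equiv> \<tau> + w j * (b j - \<tau>) / (W + w j)"
  shows "threshold (insert j S) (W + w j) \<tau>'" and "\<tau> \<le> \<tau>'"
proof -
  have fin: "finite S" by (rule threshold_finite[OF thr])
  have pos: "W + w j > 0"
    using thr sum_w_nonneg[of S] w_pos[OF j(1)] by (auto simp: threshold_def)
  have "(W + w j) * \<tau>' = (W + w j) * \<tau> + w j * (b j - \<tau>)"
    using pos by (simp add: \<tau>'_def distrib_left)
  then show "threshold (insert j S) (W + w j) \<tau>'"
    using thr j fin by (simp add: threshold_def algebra_simps)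
  show "\<tau> \<le> \<tau>'"
    using pos j w_pos[OF j(1)] by (simp add: \<tau>'_def)
qed

lemma threshold_ex_above:
  assumes thr: "threshold S W \<tau>"
  obtains k where "k \<in> S" "b k > \<tau>"
proof -
  have "(\<Sum>i\<in>S. w i * (b i - \<tau>)) > 0"
    using thr D_pos
    by (auto simp: threshold_def right_diff_distrib sum_subtractf simp flip: sum_distrib_right)
  then obtain k where "k \<in> S" "w k * (b k - \<tau>) > 0"
    by (meson sum_nonpos not_le)
  moreover have "w k > 0"
    using thr \<open>k \<in> S\<close> w_pos by (auto simp: threshold_def)
  ultimately show thesis
    using that by (simp add: zero_less_mult_iff)
qed

text \<open>An element of \<open>S\<close> above the threshold differs from \<open>i\<close> and
  survives, so the remaining weight is positive. Taking out a nonpositive term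
  \<open>w i * (b i - \<tau>)\<close> leaves a sum that is at least \<open>D\<close>, so the root
  cannot move down.\<close>

lemma threshold_remove:
  assumes thr: "threshold S W \<tau>" and i: "i \<in> S" "b i \<le> \<tau>"
  defines "\<tau>' \<equiv> \<tau> + w i * (\<tau> - b i) / (W - w i)"
  shows "W - w i > 0" and "threshold (S - {i}) (W - w i) \<tau>'" and "\<tau> \<le> \<tau>'"
proof -
  have fin: "finite S" by (rule threshold_finite[OF thr])
  have sub: "S \<subseteq> {1..n}" using thr by (simp add: threshold_def)
  obtain k where "k \<in> S" "b k > \<tau>" by (rule threshold_ex_above[OF thr])
  then have "S - {i} \<noteq> {}" using i by fastforce
  then have "sum w (S - {i}) > 0"
    using fin sub w_pos by (intro sum_pos) auto
  then show pos: "W - w i > 0"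
    using thr fin i by (simp add: threshold_def sum_diff1)
  have "(W - w i) * \<tau>' = (W - w i) * \<tau> + w i * (\<tau> - b i)"
    using pos by (simp add: \<tau>'_def distrib_left)
  then show "threshold (S - {i}) (W - w i) \<tau>'"
    using thr i fin by (auto simp: threshold_def sum_diff1 algebra_simps)
  show "\<tau> \<le> \<tau>'"
    using pos i sub w_pos[of i] by (auto simp: \<tau>'_def)
qed

text \<open>Lagrangian argument with multiplier from \<open>\<tau>\<close>: for feasible
  \<open>y\<close>, each term of the objective dominates an affine function of \<open>y i\<close>
  with slope \<open>2 * \<tau> * w i\<close>. Slopes proportional to \<open>w i\<close> make the sum
  of these bounds constant on the feasible set.\<close>

lemma threshold_optimal:
  assumes thr: "threshold S W \<tau>" and above: "\<forall>k\<in>S. b k > \<tau>"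
    and below: "\<forall>k\<in>{1..n} - S. b k \<le> \<tau>"
  shows "optimal_solution n w b c (\<lambda>i. if i \<in> S then \<tau> else b i)"
proof -
  let ?x = "\<lambda>i. if i \<in> S then \<tau> else b i"
  have sub: "S \<subseteq> {1..n}" using thr by (simp add: threshold_def)
  have "(\<Sum>i=1..n. w i * b i) - (\<Sum>i=1..n. w i * ?x i)
      = (\<Sum>i=1..n. if i \<in> S then w i * b i - w i * \<tau> else 0)"
    unfolding sum_subtractf[symmetric] by (rule sum.cong) auto
  also have "\<dots> = (\<Sum>i\<in>S. w i * b i - w i * \<tau>)"
    using sub by (simp add: sum.inter_restrict[symmetric] Int_absorb1)
  also have "\<dots> = D"
    using thr by (auto simp: threshold_def sum_subtractf sum_distrib_right)
  finally have sum_x: "(\<Sum>i=1..n. w i * ?x i) = c"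
    by (simp add: deficit_def)
  have feas: "feasible n w b c ?x"
    using sum_x above unfolding feasible_def by (auto intro: less_imp_le)
  have "objective n w ?x \<le> objective n w y" if y: "feasible n w b c y" for y
  proof -
    \<comment> \<open>The multiplier term \<open>2 * \<tau> * (y i - ?x i)\<close> sums to zero over two feasible points.\<close>
    have "w i * ((?x i)\<^sup>2 + 2 * \<tau> * (y i - ?x i)) \<le> w i * (y i)\<^sup>2" if i: "i \<in> {1..n}" for i
    proof -
      \<comment> \<open>Complementary slackness: on \<open>S\<close> the first factor vanishes; off
        \<open>S\<close> both factors are nonpositive, since
        \<open>y i \<le> b i \<le> \<tau>\<close> and \<open>?x i = b i\<close>.\<close>
      have "(?x i - \<tau>) * (y i - ?x i) \<ge> 0"
        using y below i by (auto simp: feasible_def intro!: mult_nonpos_nonpos)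
      moreover have "(y i)\<^sup>2 - ((?x i)\<^sup>2 + 2 * \<tau> * (y i - ?x i))
          = (y i - ?x i)\<^sup>2 + 2 * ((?x i - \<tau>) * (y i - ?x i))"
        by (simp add: power2_eq_square algebra_simps)
      ultimately have "(?x i)\<^sup>2 + 2 * \<tau> * (y i - ?x i) \<le> (y i)\<^sup>2"
        by (smt (verit) zero_le_power2)
      then show ?thesis
        using w_pos[OF i] by (intro mult_left_mono) auto
    qed
    then have "(\<Sum>i=1..n. w i * ((?x i)\<^sup>2 + 2 * \<tau> * (y i - ?x i))) \<le> objective n w y"
      unfolding objective_def by (rule sum_mono)
    moreover have "(\<Sum>i=1..n. w i * ((?x i)\<^sup>2 + 2 * \<tau> * (y i - ?x i)))
        = (\<Sum>i=1..n. w i * (?x i)\<^sup>2 + 2 * \<tau> * (w i * y i - w i * ?x i))"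
      by (rule sum.cong) (auto simp: algebra_simps)
    moreover have "\<dots> = objective n w ?x
          + 2 * \<tau> * ((\<Sum>i=1..n. w i * y i) - (\<Sum>i=1..n. w i * ?x i))"
      unfolding objective_def sum.distrib sum_subtractf sum_distrib_left[symmetric] ..
    ultimately show ?thesis
      using sum_x y by (simp add: feasible_def)
  qed
  then show ?thesis
    using feas unfolding optimal_solution_def is_arg_min_def by (meson not_le)
qed

text \<open>In \<open>Remove\<close>, \<open>card S = m\<close> says that the current pass has removed nothing yet, so that the
  elements already visited were compared with the current \<open>\<tau>\<close>.\<close>

fun invariant :: "dta_config \<Rightarrow> bool" where
  "invariant (Scan i J S W \<tau>) \<longleftrightarrow>
     1 \<le> i \<and> i \<le> Suc n \<and> J \<union> S \<subseteq> {1..<i} \<and> J \<inter> S = {} \<and> threshold S W \<tau> \<and>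
     (\<forall>k\<in>{1..<i} - S - J. b k \<le> \<tau>)"
| "invariant (Reinsert P S W \<tau>) \<longleftrightarrow>
     P \<subseteq> {1..n} \<and> P \<inter> S = {} \<and> threshold S W \<tau> \<and> (\<forall>k\<in>{1..n} - S - P. b k \<le> \<tau>)"
| "invariant (Remove P m S W \<tau>) \<longleftrightarrow>
     P \<subseteq> S \<and> threshold S W \<tau> \<and> (\<forall>k\<in>{1..n} - S. b k \<le> \<tau>) \<and>
     card S \<le> m \<and> (card S = m \<longrightarrow> (\<forall>k\<in>S - P. b k > \<tau>))"
| "invariant (Returned x) \<longleftrightarrow> optimal_solution n w b c x"

lemma invariant_init: "invariant (dta_init n w b c)"
proof -
  have "(w 1 * b 1 - D) / w 1 = dta_rho n w b c 1"
    using w_pos[of 1] n_pos by (simp add: dta_rho_def field_simps)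
  then show ?thesis
    using threshold_singleton[of 1] n_pos by (auto simp: dta_init_def)
qed

lemma invariant_step:
  assumes "dta_step n w b c s s'" and "invariant s"
  shows "invariant s'"
  using assms
proof (induction rule: dta_step.induct)
  case (scan_skip i \<tau> J S W)
  then show ?case by (auto simp: less_Suc_eq)
next
  case (scan_add i \<tau> W' W \<tau>' J S)
  then have "i \<in> {1..n}" "i \<notin> S" "i \<notin> J" by auto
  with scan_add have "threshold (insert i S) W' \<tau>'" "\<tau> \<le> \<tau>'"
    using threshold_insert[of S W \<tau> i] by simp_all
  moreover have "b k \<le> \<tau>'" if "k \<in> {1..<i} - S - J" for k
    using scan_add.prems that order_trans[OF _ \<open>\<tau> \<le> \<tau>'\<close>] by simp
  ultimately show ?case
    using scan_add.hyps(1) scan_add.prems \<open>i \<notin> J\<close> by (auto simp: less_Suc_eq)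
next
  case (scan_reset i \<tau> W' W \<tau>' J S)
  then have i: "i \<in> {1..n}" "i \<notin> S" "i \<notin> J" by auto
  with scan_reset have "\<tau> \<le> \<tau>'"
    using threshold_insert(2)[of S W \<tau> i] by simp
  \<comment> \<open>The failed test puts the tentative \<open>\<tau>'\<close> between the old
    threshold and the reset value, so a reset does not lower the threshold either.\<close>
  then have "\<tau> \<le> dta_rho n w b c i"
    using scan_reset.hyps by linarith
  from order_trans[OF _ this] have "b k \<le> dta_rho n w b c i" if "k \<in> {1..<i} - S - J" for k
    using scan_reset.prems that by simp
  with i show ?case
    using scan_reset.hyps(1) scan_reset.prems threshold_singleton[of i]
    by (auto simp: less_Suc_eq)
next
  case (scan_done i J S W \<tau>)
  then have "i = Suc n" by simp
  with scan_done show ?case by (auto simp: atLeastLessThanSuc_atLeastAtMost)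
next
  case (reinsert_skip j P \<tau> S W)
  then show ?case by auto
next
  case (reinsert_add j P \<tau> W' W \<tau>' S)
  then have "j \<in> {1..n}" "j \<notin> S" by auto
  with reinsert_add have "threshold (insert j S) W' \<tau>'" "\<tau> \<le> \<tau>'"
    using threshold_insert[of S W \<tau> j] by simp_all
  moreover have "b k \<le> \<tau>'" if "k \<in> {1..n} - S - P" for k
    using reinsert_add.prems that order_trans[OF _ \<open>\<tau> \<le> \<tau>'\<close>] by simp
  ultimately show ?case
    using reinsert_add.prems by auto
next
  case (reinsert_done S W \<tau>)
  then show ?case by simp
next
  case (remove_keep i P \<tau> m S W)
  then show ?case by auto
next
  case (remove_drop i P \<tau> W' W \<tau>' m S)
  then have "i \<in> S" by auto
  with remove_drop have "threshold (S - {i}) W' \<tau>'" "\<tau> \<le> \<tau>'"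
    using threshold_remove[of S W \<tau> i] by simp_all
  moreover have "b k \<le> \<tau>'" if "k \<in> {1..n} - (S - {i})" for k
    using remove_drop.hyps(2) remove_drop.prems that order_trans[OF _ \<open>\<tau> \<le> \<tau>'\<close>]
    by (cases "k = i") simp_all
  \<comment> \<open>The cardinality falls strictly below \<open>m\<close>, so the conditional clause
    of the invariant becomes vacuous for the rest of the pass.\<close>
  moreover have "card (S - {i}) < card S"
    using remove_drop.prems \<open>i \<in> S\<close> by (intro card_Diff1_less) (auto dest: threshold_finite)
  ultimately show ?case
    using remove_drop.prems by auto
next
  case (remove_again S m W \<tau>)
  then show ?case by auto
next
  case (remove_done S m W \<tau>)
  then show ?case using threshold_optimal by auto
qed

text \<open>The one possible obstruction is the nonzero divisor demanded by
  \<open>remove_drop\<close>; the invariant supplies it through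
  \<open>threshold_remove\<close>.\<close>

lemma invariant_progress:
  assumes "invariant s" and "\<nexists>x. s = Returned x"
  shows "\<exists>s'. dta_step n w b c s s'"
proof (cases s)
  case (Scan i J S W \<tau>)
  then show ?thesis
    by (metis not_le scan_skip scan_done scan_add[OF _ _ refl refl] scan_reset[OF _ _ refl refl])
next
  case (Reinsert P S W \<tau>)
  then show ?thesis
    by (metis all_not_in_conv not_le reinsert_skip reinsert_done reinsert_add[OF _ _ refl refl])
next
  case (Remove P m S W \<tau>)
  show ?thesis
  proof (cases "P = {}")
    case True
    then show ?thesis using Remove remove_again remove_done by metis
  next
    case False
    then obtain i where i: "i \<in> P" by blast
    have "W - w i \<noteq> 0" if "b i \<le> \<tau>"
      using threshold_remove(1)[of S W \<tau> i] assms(1) Remove i that by auto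
    then show ?thesis
      using Remove i remove_keep remove_drop[OF _ _ refl _ refl] by (metis not_le)
  qed
qed (use assms in blast)

text \<open>A further removal pass starts only if the previous one lowered \<open>card S\<close> below \<open>m\<close>.\<close>

fun rank :: "dta_config \<Rightarrow> nat \<times> nat \<times> nat" where
  "rank (Scan i J S W \<tau>) = (3, Suc n - i, 0)"
| "rank (Reinsert P S W \<tau>) = (2, card P, 0)"
| "rank (Remove P m S W \<tau>) = (1, m, card P)"
| "rank (Returned x) = (0, 0, 0)"

text \<open>The invariant makes the index sets finite, so that deleting an element lowers
  \<open>card\<close>, and its bound \<open>card S \<le> m\<close> makes the second component drop
  when a new pass begins.\<close>

lemma rank_step:
  assumes "dta_step n w b c s s'" and "invariant s"
  shows "(rank s', rank s) \<in> less_than <*lex*> less_than <*lex*> less_than"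
proof -
  have reinsert: "card (P - {j}) < card P" if "j \<in> P" "P \<subseteq> {1..n}" for j P
    using that finite_subset by (blast intro: card_Diff1_less)
  have remove: "card (P - {i}) < card P" if "threshold S W \<tau>" "i \<in> P" "P \<subseteq> S" for i P S W \<tau>
    using that threshold_finite finite_subset by (blast intro: card_Diff1_less)
  show ?thesis
    using assms
    \<comment> \<open>Deleting \<open>card_Diff_insert\<close> keeps the cardinalities in the form
      in which \<open>reinsert\<close> and \<open>remove\<close> state them.\<close>
    by (induction rule: dta_step.induct)
      (auto simp del: card_Diff_insert simp: reinsert intro: remove)
qed

lemma no_infinite_run:
  assumes "r 0 = dta_init n w b c" and run: "\<And>k. dta_step n w b c (r k) (r (Suc k))"
  shows False
proof -
  have inv: "invariant (r k)" for k
    by (induction k) (use assms invariant_init invariant_step in auto)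
  have "(rank (r (Suc k)), rank (r k)) \<in> less_than <*lex*> less_than <*lex*> less_than" for k
    by (rule rank_step[OF run inv])
  moreover have "wf (less_than <*lex*> less_than <*lex*> less_than)"
    by (intro wf_lex_prod wf_less_than)
  ultimately show False
    by (blast elim: wf_no_infinite_down_chainE[where f = "\<lambda>k. rank (r k)"])
qed

lemma halted_optimal:
  assumes "(dta_step n w b c)\<^sup>*\<^sup>* (dta_init n w b c) s" and "\<nexists>s'. dta_step n w b c s s'"
  shows "\<exists>x. s = Returned x \<and> optimal_solution n w b c x"
proof -
  have "invariant s"
    using assms(1) by (induction rule: rtranclp_induct) (auto intro: invariant_init invariant_step)
  then show ?thesis
    using invariant_progress assms(2) by force
qed

end

theorem theorem4:
  fixes n :: nat and w b :: "nat \<Rightarrow> real" and c :: real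
  assumes "n \<ge> 1"
    and "\<forall>i\<in>{1..n}. w i > 0"
    and "c < (\<Sum>i=1..n. w i * b i)"
  shows "(\<nexists>r :: nat \<Rightarrow> dta_config.
            r 0 = dta_init n w b c \<and> (\<forall>k. dta_step n w b c (r k) (r (Suc k))))
       \<and> (\<forall>s. (dta_step n w b c)\<^sup>*\<^sup>* (dta_init n w b c) s \<and> (\<nexists>s'. dta_step n w b c s s')
            \<longrightarrow> (\<exists>x. s = Returned x \<and> optimal_solution n w b c x))"
proof -
  interpret dta_input n w b c
    using assms by unfold_locales auto
  show ?thesis
    using no_infinite_run halted_optimal by blast
qed

end
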